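(* Let $H_A,H_B$ be self-adjoint operators on Hilbert spaces $\mathcal H_A,\mathcal H_B$, let $|\phi_0\rangle\in\mathcal H_A$, $|\varphi_0\rangle\in\mathcal H_B$ be unit vectors in the domains of $H_A$, $H_B$ respectively, and let $|\psi_x\rangle=e^{-\mathrm i xH_A\otimes H_B}\,|\phi_0\rangle\otimes|\varphi_0\rangle$. Write $\langle H_A^2\rangle=\|H_A\phi_0\|^2$, $\langle H_B^2\rangle=\|H_B\varphi_0\|^2$, $\langle H_A\rangle=\langle\phi_0|H_A|\phi_0\rangle$, $\langle H_B\rangle=\langle\varphi_0|H_B|\varphi_0\rangle$; assume $\langle H_A^2\rangle,\langle H_B^2\rangle>0$ and put $$\varrho^{\perp A}=\frac{H_A|\phi_0\rangle\langle\phi_0|H_A}{\langle H_A^2\rangle}.$$ Consider post-selection acting on $A$ only, with $L$ retained outcomes $\omega\in\checkmark$ whose POVM operators are $E_\omega^A\otimes\mathbb I^B$, and let $q_\omega>0$ with $\sum_{\omega\in\checkmark}q_\omega=1$. All quantities below are evaluated at $x=0$. (a) If $\langle H_A\rangle=0$ and $E_\omega^A=q_\omega\,\varrho^{\perp A}+\varepsilon\,|\phi_0\rangle\langle\phi_0|$ for $\omega\in\checkmark$, with $0<\varepsilon<1/L$, then the post-selection is lossless ($\gamma=0$) and its compression gain and capacity satisfy $\eta=Lc=1/\varepsilon$. (b) If $\langle H_A\rangle\neq0$ and $\langle H_B\rangle=0$, and $E_\omega^A=q_\omega\,\varrho^{\perp A}$ for $\omega\in\checkmark$, then the post-selection is lossless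 ($\gamma=0$), its compression capacity is $c=\langle H_A^2\rangle/\langle H_A\rangle^2$, and its compression gain is $\eta=Lc$.
   Context: For a differentiable family of unit vectors $|\psi_x\rangle$ with $\rho_x=|\psi_x\rangle\langle\psi_x|$, the quantum Fisher information (QFI) is $I(\rho_x)=4\left(\langle\partial_x\psi_x|\partial_x\psi_x\rangle-|\langle\psi_x|\partial_x\psi_x\rangle|^2\right)$. A post-selection measurement is a finite family of bounded operators $\{K_\omega\}_{\omega\in\Omega}$ with POVM operators $E_\omega=K_\omega^\dagger K_\omega$, $\sum_{\omega\in\Omega}E_\omega=\mathbb I$, and $\Omega=\checkmark\cup\times$ split into disjoint sets of retained and discarded outcomes (the discarded POVM operators complete the retained ones to $\mathbb I$). The $K_\omega$ are held fixed when differentiating in $x$. Put $p(\omega|x)=\langle\psi_x|E_\omega|\psi_x\rangle$, and let $\sigma_{x|\omega}$ be the pure state with unit vector $K_\omega|\psi_x\rangle/\sqrt{p(\omega|x)}$, whose QFI is $I(\sigma_{x|\omega})$. The loss is $\gamma=1-\sum_{\omega\in\checkmark}p(\omega|x)I(\sigma_{x|\omega})/I(\rho_x)$, the compression capacity is $c=1/\sum_{\omega\in\checkmark}p(\omega|x)$, and the compression gain is $\eta=\sum_{\omega\in\checkmark}I(\sigma_{x|\omega})/I(\rho_x)$. *)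

theory Defs
  imports "HOL-Analysis.Analysis"
begin

section \<open>Complex Hilbert spaces\<close>

text \<open>The inner product is antilinear in the first and linear in the second argument.\<close>

class chilbert_space = banach +
  fixes scaleC :: "complex \<Rightarrow> 'a \<Rightarrow> 'a"  (infixr "*\<^sub>C" 75)
    and cinner :: "'a \<Rightarrow> 'a \<Rightarrow> complex"
  assumes scaleC_add_right: "c *\<^sub>C (x + y) = c *\<^sub>C x + c *\<^sub>C y"
    and scaleC_add_left: "(c + d) *\<^sub>C x = c *\<^sub>C x + d *\<^sub>C x"
    and scaleC_scaleC: "c *\<^sub>C d *\<^sub>C x = (c * d) *\<^sub>C x"
    and scaleR_scaleC: "r *\<^sub>R x = complex_of_real r *\<^sub>C x"
    and cinner_commute: "cinner x y = cnj (cinner y x)"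
    and cinner_add_right: "cinner x (y + z) = cinner x y + cinner x z"
    and cinner_scaleC_right: "cinner x (c *\<^sub>C y) = c * cinner x y"
    and norm_eq_sqrt_cinner: "norm x = sqrt (Re (cinner x x))"

instantiation complex :: chilbert_space
begin

definition scaleC_complex :: "complex \<Rightarrow> complex \<Rightarrow> complex"
  where "scaleC_complex c x = c * x"

definition cinner_complex :: "complex \<Rightarrow> complex \<Rightarrow> complex"
  where "cinner_complex x y = cnj x * y"

instance
  by standard
    (auto simp: scaleC_complex_def cinner_complex_def algebra_simps scaleR_conv_of_real
      cmod_def power2_eq_square)

end


section \<open>Bounded operators\<close>

definition bounded_clinear :: "('a::chilbert_space \<Rightarrow> 'b::chilbert_space) \<Rightarrow> bool"
  where "bounded_clinear A \<longleftrightarrow> bounded_linear A \<and> (\<forall>c x. A (c *\<^sub>C x) = c *\<^sub>C A x)"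

definition badjoint :: "('a::chilbert_space \<Rightarrow> 'b::chilbert_space) \<Rightarrow> 'b \<Rightarrow> 'a"
  where "badjoint A y = (THE z. \<forall>x. cinner z x = cinner y (A x))"

text \<open>\<open>ketbra a b\<close> is the operator $|a\rangle\langle b|$.\<close>

definition ketbra :: "'a::chilbert_space \<Rightarrow> 'b::chilbert_space \<Rightarrow> 'b \<Rightarrow> 'a"
  where "ketbra a b = (\<lambda>v. cinner b v *\<^sub>C a)"


section \<open>Unbounded operators, represented by their graphs\<close>

definition linear_graph :: "('a::chilbert_space \<times> 'b::chilbert_space) set \<Rightarrow> bool"
  where "linear_graph T \<longleftrightarrow>
    subspace T \<and> (\<forall>c x y. (x, y) \<in> T \<longrightarrow> (c *\<^sub>C x, c *\<^sub>C y) \<in> T) \<and> single_valued T"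

definition op_app :: "('a \<times> 'b) set \<Rightarrow> 'a \<Rightarrow> 'b"
  where "op_app T x = (THE y. (x, y) \<in> T)"

definition adjoint_graph ::
    "('a::chilbert_space \<times> 'b::chilbert_space) set \<Rightarrow> ('b \<times> 'a) set"
  where "adjoint_graph T = {(y, z). \<forall>(x, w)\<in>T. cinner y w = cinner z x}"

definition selfadjoint :: "('a::chilbert_space \<times> 'a) set \<Rightarrow> bool"
  where "selfadjoint T \<longleftrightarrow>
    linear_graph T \<and> closure (Domain T) = UNIV \<and> adjoint_graph T = T"

text \<open>For a self-adjoint \<open>T\<close>, \<open>U t\<close> is $e^{-\mathrm{i}tT}$: by Stone's theorem there is exactly one
  strongly continuous one-parameter unitary group with generator \<open>- \<i> T\<close> (domains included).
  Surjectivity of \<open>U t\<close> follows from the group law.\<close>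

definition is_unitary_exp ::
    "('a::chilbert_space \<times> 'a) set \<Rightarrow> (real \<Rightarrow> 'a \<Rightarrow> 'a) \<Rightarrow> bool"
  where "is_unitary_exp T U \<longleftrightarrow>
    (\<forall>t. bounded_clinear (U t)) \<and>
    (\<forall>t x y. cinner (U t x) (U t y) = cinner x y) \<and>
    U 0 = id \<and> (\<forall>s t. U (s + t) = U s \<circ> U t) \<and>
    (\<forall>x. continuous_on UNIV (\<lambda>t. U t x)) \<and>
    T = {(x, y). ((\<lambda>t. U t x) has_vector_derivative ((- \<i>) *\<^sub>C y)) (at 0)}"


section \<open>Tensor products\<close>

text \<open>The Hilbert space \<open>'c\<close> with the map \<open>tens\<close> is a Hilbert tensor product of \<open>'a\<close> and \<open>'b\<close>,
  which determines it up to a unique unitary. The set of pure tensors is closed under complex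
  scalars, so its real span is its complex span.\<close>

definition hilbert_tensor ::
    "('a::chilbert_space \<Rightarrow> 'b::chilbert_space \<Rightarrow> 'c::chilbert_space) \<Rightarrow> bool"
  where "hilbert_tensor tens \<longleftrightarrow>
    (\<forall>a a' b. tens (a + a') b = tens a b + tens a' b) \<and>
    (\<forall>a b b'. tens a (b + b') = tens a b + tens a b') \<and>
    (\<forall>c a b. tens (c *\<^sub>C a) b = c *\<^sub>C tens a b \<and> tens a (c *\<^sub>C b) = c *\<^sub>C tens a b) \<and>
    (\<forall>a a' b b'. cinner (tens a b) (tens a' b') = cinner a a' * cinner b b') \<and>
    closure (span {tens a b | a b. True}) = UNIV"

text \<open>The operator $S\otimes T$ is the closure of its restriction to the algebraic tensor product
  of the domains (self-adjoint if \<open>S\<close> and \<open>T\<close> are). As above, the real span is the complex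
  span.\<close>

definition tensor_graph ::
    "('a::chilbert_space \<Rightarrow> 'b::chilbert_space \<Rightarrow> 'c::chilbert_space) \<Rightarrow>
      ('a \<times> 'a) set \<Rightarrow> ('b \<times> 'b) set \<Rightarrow> ('c \<times> 'c) set"
  where "tensor_graph tens S T =
    closure (span {(tens a b, tens a' b') | a a' b b'. (a, a') \<in> S \<and> (b, b') \<in> T})"

text \<open>For bounded operators, $C = A\otimes B$.\<close>

definition is_tensor_op ::
    "('a::chilbert_space \<Rightarrow> 'b::chilbert_space \<Rightarrow> 'c::chilbert_space) \<Rightarrow>
      ('c \<Rightarrow> 'c) \<Rightarrow> ('a \<Rightarrow> 'a) \<Rightarrow> ('b \<Rightarrow> 'b) \<Rightarrow> bool"
  where "is_tensor_op tens C A B \<longleftrightarrow>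
    bounded_clinear C \<and> (\<forall>a b. C (tens a b) = tens (A a) (B b))"


section \<open>Quantum Fisher information and post-selection\<close>

definition QFI :: "(real \<Rightarrow> 'h::chilbert_space) \<Rightarrow> real \<Rightarrow> real"
  where "QFI \<psi> x = (let d = vector_derivative \<psi> (at x) in
    4 * (Re (cinner d d) - (cmod (cinner (\<psi> x) d))\<^sup>2))"

definition povm :: "('w \<Rightarrow> 'h::chilbert_space \<Rightarrow> 'h) \<Rightarrow> 'w \<Rightarrow> 'h \<Rightarrow> 'h"
  where "povm K \<omega> = badjoint (K \<omega>) \<circ> K \<omega>"

text \<open>\<open>R\<close> and \<open>D\<close> are the sets of retained and discarded outcomes.\<close>

definition post_selection ::
    "'w set \<Rightarrow> 'w set \<Rightarrow> ('w \<Rightarrow> 'h::chilbert_space \<Rightarrow> 'h) \<Rightarrow> bool"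
  where "post_selection R D K \<longleftrightarrow>
    finite R \<and> finite D \<and> R \<inter> D = {} \<and>
    (\<forall>\<omega>\<in>R \<union> D. bounded_clinear (K \<omega>)) \<and>
    (\<forall>v. (\<Sum>\<omega>\<in>R \<union> D. povm K \<omega> v) = v)"

text \<open>Below, \<open>\<psi>\<close> is the whole family of unit vectors. The inner product in
  \<open>outcome_prob\<close> is real.\<close>

definition outcome_prob ::
    "('w \<Rightarrow> 'h::chilbert_space \<Rightarrow> 'h) \<Rightarrow> (real \<Rightarrow> 'h) \<Rightarrow> 'w \<Rightarrow> real \<Rightarrow> real"
  where "outcome_prob K \<psi> \<omega> x = Re (cinner (\<psi> x) (povm K \<omega> (\<psi> x)))"

definition cond_state ::
    "('w \<Rightarrow> 'h::chilbert_space \<Rightarrow> 'h) \<Rightarrow> (real \<Rightarrow> 'h) \<Rightarrow> 'w \<Rightarrow> real \<Rightarrow> 'h"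
  where "cond_state K \<psi> \<omega> x = (1 / sqrt (outcome_prob K \<psi> \<omega> x)) *\<^sub>R K \<omega> (\<psi> x)"

definition loss ::
    "'w set \<Rightarrow> ('w \<Rightarrow> 'h::chilbert_space \<Rightarrow> 'h) \<Rightarrow> (real \<Rightarrow> 'h) \<Rightarrow> real \<Rightarrow> real"
  where "loss R K \<psi> x =
    1 - (\<Sum>\<omega>\<in>R. outcome_prob K \<psi> \<omega> x * QFI (cond_state K \<psi> \<omega>) x / QFI \<psi> x)"

definition compression_capacity ::
    "'w set \<Rightarrow> ('w \<Rightarrow> 'h::chilbert_space \<Rightarrow> 'h) \<Rightarrow> (real \<Rightarrow> 'h) \<Rightarrow> real \<Rightarrow> real"
  where "compression_capacity R K \<psi> x = 1 / (\<Sum>\<omega>\<in>R. outcome_prob K \<psi> \<omega> x)"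

definition compression_gain ::
    "'w set \<Rightarrow> ('w \<Rightarrow> 'h::chilbert_space \<Rightarrow> 'h) \<Rightarrow> (real \<Rightarrow> 'h) \<Rightarrow> real \<Rightarrow> real"
  where "compression_gain R K \<psi> x = (\<Sum>\<omega>\<in>R. QFI (cond_state K \<psi> \<omega>) x / QFI \<psi> x)"


section \<open>Moments of a self-adjoint operator\<close>

definition moment1 :: "('a::chilbert_space \<times> 'a) set \<Rightarrow> 'a \<Rightarrow> complex"
  where "moment1 T \<phi> = cinner \<phi> (op_app T \<phi>)"

definition moment2 :: "('a::chilbert_space \<times> 'a) set \<Rightarrow> 'a \<Rightarrow> real"
  where "moment2 T \<phi> = (norm (op_app T \<phi>))\<^sup>2"

definition rho_perp :: "('a::chilbert_space \<times> 'a) set \<Rightarrow> 'a \<Rightarrow> 'a \<Rightarrow> 'a"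
  where "rho_perp T \<phi> =
    (\<lambda>v. (1 / moment2 T \<phi>) *\<^sub>R ketbra (op_app T \<phi>) (op_app T \<phi>) v)"

end

theory Submission
  imports Defs
begin

text \<open>The derivative of the family at \<open>0\<close> is \<open>-\<i> w\<close> with \<open>w = H\<^sub>A\<phi>\<^sub>0 \<otimes> H\<^sub>B\<chi>\<^sub>0\<close>. Normalising
  \<open>K\<psi>\<close> removes the component of \<open>K w\<close> along \<open>K\<psi>\<close>, so with \<open>E = K\<^sup>\<dagger>K\<close> one gets
  \<open>p I(\<sigma>) = 4 (\<langle>w|E w\<rangle> - \<bar>\<langle>\<psi>|E w\<rangle>\<bar>\<^sup>2 / p)\<close>. Both choices of \<open>E\<^sup>A\<close> have \<open>H\<^sub>A\<phi>\<^sub>0\<close> as an eigenvector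
  with eigenvalue \<open>q\<close>, and the subtracted term vanishes together with \<open>\<langle>H\<^sub>A\<rangle>\<close> or \<open>\<langle>H\<^sub>B\<rangle>\<close>; hence
  outcome \<open>\<omega>\<close> keeps exactly the fraction \<open>q \<omega>\<close> of the Fisher information.\<close>


section \<open>Inner product calculus\<close>

lemma cinner_add_left: "cinner (x + y) z = cinner x z + cinner y z"
  by (metis cinner_add_right cinner_commute complex_cnj_add)

lemma cinner_scaleC_left: "cinner (c *\<^sub>C x) y = cnj c * cinner x y"
  by (metis cinner_scaleC_right cinner_commute complex_cnj_mult)

lemma cinner_scaleR_left: "cinner (r *\<^sub>R x) y = of_real r * cinner x y"
  by (simp add: scaleR_scaleC cinner_scaleC_left)

lemma cinner_scaleR_right: "cinner x (r *\<^sub>R y) = of_real r * cinner x y"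
  by (simp add: scaleR_scaleC cinner_scaleC_right)

lemma cinner_zero_right [simp]: "cinner x 0 = 0"
  using cinner_scaleR_right[of x 0 0] by simp

lemma cinner_minus_left: "cinner (- x) y = - cinner x y"
  using cinner_scaleR_left[of "-1" x y] by simp

lemma cinner_minus_right: "cinner x (- y) = - cinner x y"
  using cinner_scaleR_right[of x "-1" y] by simp

lemma cinner_diff_left: "cinner (x - y) z = cinner x z - cinner y z"
  using cinner_add_left[of x "- y" z] by (simp add: cinner_minus_left)

lemma cinner_diff_right: "cinner x (y - z) = cinner x y - cinner x z"
  using cinner_add_right[of x y "- z"] by (simp add: cinner_minus_right)

text \<open>Positivity is hidden in the norm axiom: \<open>sqrt\<close> is negative on negative
  reals, so a nonnegative norm forces a nonnegative real part. Conjugate symmetry removes the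
  imaginary part.\<close>

lemma cinner_self: "cinner x x = complex_of_real ((norm x)\<^sup>2)"
proof -
  have "Re (cinner x x) \<ge> 0"
    using norm_eq_sqrt_cinner[of x] norm_ge_zero[of x] by (metis real_sqrt_ge_0_iff)
  then have "Re (cinner x x) = (norm x)\<^sup>2"
    by (simp add: norm_eq_sqrt_cinner)
  moreover have "Im (cinner x x) = 0"
    using cinner_commute[of x x] by (metis Im_complex_of_real Reals_cnj_iff complex_is_Real_iff)
  ultimately show ?thesis
    by (simp add: complex_eq_iff)
qed

lemma Re_cinner_commute: "Re (cinner x y) = Re (cinner y x)"
  by (metis cinner_commute complex_cnj(1) cnj.simps(1))

lemma norm_add_sq: "(norm (x + y))\<^sup>2 = (norm x)\<^sup>2 + 2 * Re (cinner x y) + (norm y)\<^sup>2"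
  for x y :: "'a::chilbert_space"
proof -
  have "Re (cinner (x + y) (x + y))
      = Re (cinner x x) + Re (cinner x y) + Re (cinner y x) + Re (cinner y y)"
    by (simp add: cinner_add_left cinner_add_right)
  then show ?thesis
    using Re_cinner_commute[of y x] by (simp add: cinner_self)
qed

text \<open>Cauchy-Schwarz, obtained by squaring the triangle inequality and comparing cross
  terms.\<close>

lemma Re_cinner_le: "Re (cinner x y) \<le> norm x * norm y"
proof -
  have "(norm (x + y))\<^sup>2 \<le> (norm x + norm y)\<^sup>2"
    by (intro power_mono norm_triangle_ineq) simp
  then show ?thesis
    by (simp add: norm_add_sq power2_sum)
qed

lemma norm_scaleC: "norm (c *\<^sub>C x) = cmod c * norm x"
proof -
  have "complex_of_real ((norm (c *\<^sub>C x))\<^sup>2) = of_real ((cmod c * norm x)\<^sup>2)"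
    unfolding cinner_self[symmetric] cinner_scaleC_left cinner_scaleC_right
    using complex_norm_square[of c]
    by (simp add: cinner_self power_mult_distrib mult.assoc[symmetric])
  then have "(norm (c *\<^sub>C x))\<^sup>2 = (cmod c * norm x)\<^sup>2"
    using of_real_eq_iff by blast
  then show ?thesis
    by simp
qed

text \<open>Serves twice: as the product rule for squared norms, and as boundedness of the
  functionals to which Riesz representation is applied.\<close>

lemma bounded_bilinear_Re_cinner: "bounded_bilinear (\<lambda>x y. Re (cinner x y))"
proof
  have "\<bar>Re (cinner a b)\<bar> \<le> norm a * norm b" for a b :: 'a
    using Re_cinner_le[of a b] Re_cinner_le[of "- a" b] by (simp add: cinner_minus_left abs_le_iff)
  then show "\<exists>C. \<forall>a b :: 'a. norm (Re (cinner a b)) \<le> norm a * norm b * C"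
    by (intro exI[of _ 1]) simp
qed (simp_all add: cinner_add_left cinner_add_right cinner_scaleR_left cinner_scaleR_right)

lemma cinner_eqI:
  assumes "\<And>x. cinner a x = cinner b x"
  shows "a = b"
proof -
  have "cinner (a - b) (a - b) = 0"
    using assms by (simp add: cinner_diff_left)
  then show ?thesis
    by (simp add: cinner_self)
qed


section \<open>Existence of adjoints\<close>

text \<open>Riesz representation: the functional is represented by the minimiser of the strictly convex
  \<open>J\<close>, which exists because minimising sequences are Cauchy by the parallelogram law.\<close>

lemma riesz_Re:
  fixes f :: "'a::chilbert_space \<Rightarrow> real"
  assumes "bounded_linear f"
  obtains z where "\<And>x. Re (cinner z x) = f x"
proof -
  interpret f: bounded_linear f by fact
  obtain B where B: "\<And>x. norm (f x) \<le> norm x * B"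
    using f.bounded by blast
  define J where "J x = (norm x)\<^sup>2 - 2 * f x" for x
  \<comment> \<open>Completing the square in \<open>norm x\<close>.\<close>
  have J_lower: "- B\<^sup>2 \<le> J x" for x
  proof -
    have "f x \<le> norm x * B"
      using B[of x] by simp
    moreover have "0 \<le> (norm x - B)\<^sup>2"
      by simp
    ultimately show ?thesis
      by (simp add: J_def power2_diff)
  qed
  define m where "m = Inf (range J)"
  have bdd: "bdd_below (range J)"
    using J_lower by (auto intro: bdd_belowI[where m = "- B\<^sup>2"])
  have m_le: "m \<le> J x" for x
    unfolding m_def by (rule cInf_lower) (use bdd in auto)
  have "\<exists>x. J x < m + 1 / real (Suc n)" for n
    using cInf_lessD[of "range J" "m + 1 / real (Suc n)"] unfolding m_def by auto
  then obtain X where X: "\<And>n. J (X n) < m + 1 / real (Suc n)"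
    by metis
  \<comment> \<open>The linear part of \<open>J\<close> cancels between two points and their
    midpoint, so only the parallelogram law of the norm remains.\<close>
  have parallelogram: "(norm (x - y))\<^sup>2 = 2 * (J x + J y - 2 * J ((1/2) *\<^sub>R (x + y)))" for x y
  proof -
    have "(norm (x - y))\<^sup>2 = (norm x)\<^sup>2 - 2 * Re (cinner x y) + (norm y)\<^sup>2"
      using norm_add_sq[of x "- y"] by (simp add: cinner_minus_right)
    moreover have "J ((1/2) *\<^sub>R (x + y)) = (norm (x + y))\<^sup>2 / 4 - (f x + f y)"
      by (simp add: J_def f.scaleR f.add power_divide add_divide_distrib)
    ultimately show ?thesis
      unfolding J_def[of x] J_def[of y] norm_add_sq[of x y]
      by (simp add: add_divide_distrib algebra_simps)
  qed
  \<comment> \<open>\<open>X k\<close> and \<open>X l\<close> are nearly minimal, while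
    \<open>J\<close> at their midpoint cannot drop below \<open>m\<close>.\<close>
  have dist_X: "(norm (X k - X l))\<^sup>2 < 2 * (1 / real (Suc k) + 1 / real (Suc l))" for k l
  proof -
    define h where "h = (1/2) *\<^sub>R (X k + X l)"
    have "(norm (X k - X l))\<^sup>2 = 2 * (J (X k) + J (X l) - 2 * J h)"
      unfolding h_def by (rule parallelogram)
    then show ?thesis
      using X[of k] X[of l] m_le[of h] by argo
  qed
  have "Cauchy X"
  proof (rule CauchyI)
    fix e :: real
    assume "0 < e"
    \<comment> \<open>With this threshold the two error terms, doubled in \<open>dist_X\<close>,
      stay below \<open>e\<^sup>2\<close>.\<close>
    then obtain N where N: "inverse (real (Suc N)) < e\<^sup>2 / 4"
      using reals_Archimedean[of "e\<^sup>2 / 4"] by auto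
    have "norm (X k - X l) < e" if "N \<le> k" "N \<le> l" for k l
    proof -
      have "1 / real (Suc k) \<le> 1 / real (Suc N)" "1 / real (Suc l) \<le> 1 / real (Suc N)"
        using that by (simp_all add: frac_le)
      then have "(norm (X k - X l))\<^sup>2 < e\<^sup>2"
        using dist_X[of k l] N unfolding inverse_eq_divide by argo
      then show ?thesis
        using \<open>0 < e\<close> by (simp add: power2_less_imp_less)
    qed
    then show "\<exists>N. \<forall>k\<ge>N. \<forall>l\<ge>N. norm (X k - X l) < e"
      by blast
  qed
  then obtain z where z: "X \<longlonglongrightarrow> z"
    using Cauchy_convergent convergent_def by blast
  have "(\<lambda>n. J (X n)) \<longlonglongrightarrow> J z"
    unfolding J_def by (intro tendsto_intros f.tendsto z)
  moreover have "(\<lambda>n. m + 1 / real (Suc n)) \<longlonglongrightarrow> m + 0"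
    by (intro tendsto_intros LIMSEQ_Suc lim_1_over_n)
  ultimately have "J z \<le> m + 0"
    by (rule LIMSEQ_le) (use X less_imp_le in blast)
  then have z_min: "J z \<le> J x" for x
    using m_le[of x] by simp
  have "Re (cinner z h) = f h" for h
  proof -
    define r where "r = Re (cinner z h) - f h"
    \<comment> \<open>The increment of \<open>J\<close> from its minimiser \<open>z\<close> along
      the direction \<open>h\<close>.\<close>
    have ineq: "0 \<le> 2 * t * r + t\<^sup>2 * (norm h)\<^sup>2" for t :: real
      using z_min[of "z + t *\<^sub>R h"]
      by (simp add: J_def r_def f.add f.scaleR norm_add_sq cinner_scaleR_right power_mult_distrib
          algebra_simps)
    show ?thesis
    proof (cases "h = 0")
      case True
      then show ?thesis by (simp add: f.zero)
    next
      case False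
      \<comment> \<open>The chosen \<open>t\<close> is the vertex of the quadratic, where its value
        is nonnegative only if \<open>r = 0\<close>.\<close>
      have "0 \<le> - (r\<^sup>2 / (norm h)\<^sup>2)"
        using ineq[of "- r / (norm h)\<^sup>2"] False by (simp add: field_simps power2_eq_square)
      then have "r = 0"
        using False by (simp add: divide_le_0_iff)
      then show ?thesis
        by (simp add: r_def)
    qed
  qed
  then show thesis
    by (rule that)
qed

text \<open>\<open>badjoint\<close> is a definite description: Riesz representation supplies
  existence, \<open>cinner_eqI\<close> uniqueness.\<close>

lemma cinner_badjoint:
  assumes "bounded_clinear A"
  shows "cinner (badjoint A y) x = cinner y (A x)"
proof -
  have lin: "bounded_linear A" and sc: "\<And>c x. A (c *\<^sub>C x) = c *\<^sub>C A x"
    using assms by (auto simp: bounded_clinear_def)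
  have "bounded_linear (\<lambda>x. Re (cinner y (A x)))"
    using bounded_linear_compose[OF
        bounded_bilinear.bounded_linear_right[OF bounded_bilinear_Re_cinner] lin] .
  then obtain z where z: "\<And>x. Re (cinner z x) = Re (cinner y (A x))"
    by (rule riesz_Re) blast
  \<comment> \<open>Riesz fixes only real parts; multiplying the argument by the imaginary unit
    turns imaginary parts into real ones.\<close>
  have "Im (cinner z x) = Im (cinner y (A x))" for x
    using z[of "\<i> *\<^sub>C x"] by (simp add: sc cinner_scaleC_right)
  then have eq: "\<forall>x. cinner z x = cinner y (A x)"
    using z by (simp add: complex_eq_iff)
  have "\<forall>x. cinner (badjoint A y) x = cinner y (A x)"
    unfolding badjoint_def by (rule theI[of _ z]) (use eq in \<open>auto intro: cinner_eqI\<close>)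
  then show ?thesis ..
qed

lemma cinner_povm:
  assumes "bounded_clinear (K \<omega>)"
  shows "cinner x (povm K \<omega> y) = cinner (K \<omega> x) (K \<omega> y)"
  using cinner_badjoint[OF assms, of "K \<omega> y" x]
  by (metis cinner_commute comp_apply povm_def)


section \<open>Fisher information of families with a given velocity\<close>

text \<open>The factor \<open>- \<i>\<close> has modulus one and drops out of both terms.\<close>

lemma QFI_eq:
  assumes "(\<psi> has_vector_derivative (- \<i>) *\<^sub>C w) (at x)"
  shows "QFI \<psi> x = 4 * ((norm w)\<^sup>2 - (cmod (cinner (\<psi> x) w))\<^sup>2)"
  using vector_derivative_at[OF assms]
  by (simp add: QFI_def cinner_self norm_scaleC cinner_scaleC_right norm_mult)

text \<open>Normalisation removes the real part of \<open>cinner (g x) g'\<close> from the velocity,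
  and the overlap term of the QFI removes the imaginary part; together they subtract the full
  squared modulus.\<close>

lemma QFI_normalised:
  fixes g :: "real \<Rightarrow> 'a::chilbert_space"
  assumes g: "(g has_vector_derivative g') (at x)" and nz: "g x \<noteq> 0"
  shows "QFI (\<lambda>t. (1 / norm (g t)) *\<^sub>R g t) x
    = 4 * ((norm g')\<^sup>2 / (norm (g x))\<^sup>2 - (cmod (cinner (g x) g'))\<^sup>2 / (norm (g x)) ^ 4)"
proof -
  define n where "n = norm (g x)"
  define r where "r = Re (cinner (g x) g')"
  define s where "s = Im (cinner (g x) g')"
  have n: "n > 0"
    using nz by (simp add: n_def)
  have sq: "(\<lambda>t. Re (cinner (g t) (g t))) = (\<lambda>t. (norm (g t))\<^sup>2)"
    by (simp add: cinner_self)
  \<comment> \<open>The norm is differentiated as the square root of its square, which is smooth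
    here because \<open>n > 0\<close>.\<close>
  have "((\<lambda>t. (norm (g t))\<^sup>2) has_vector_derivative (2 * r)) (at x)"
    using bounded_bilinear.has_vector_derivative[OF bounded_bilinear_Re_cinner g g]
    by (simp add: sq r_def Re_cinner_commute[of g' "g x"])
  then have "((\<lambda>t. (norm (g t))\<^sup>2) has_real_derivative (2 * r)) (at x)"
    by (simp add: has_real_derivative_iff_has_vector_derivative)
  from DERIV_chain2[OF DERIV_real_sqrt this]
  have "((\<lambda>t. sqrt ((norm (g t))\<^sup>2)) has_real_derivative (inverse (sqrt (n\<^sup>2)) / 2 * (2 * r))) (at x)"
    using n by (simp add: n_def)
  then have "((\<lambda>t. norm (g t)) has_real_derivative (r / n)) (at x)"
    using n by (simp add: field_simps)
  from DERIV_inverse'[OF this]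
  have "((\<lambda>t. 1 / norm (g t)) has_real_derivative (- (r / n ^ 3))) (at x)"
    using n nz by (simp add: n_def[symmetric] inverse_eq_divide power3_eq_cube)
  from has_vector_derivative_scaleR[OF this g]
  have d: "((\<lambda>t. (1 / norm (g t)) *\<^sub>R g t) has_vector_derivative
      (1 / n) *\<^sub>R g' - (r / n ^ 3) *\<^sub>R g x) (at x)"
    by (simp add: n_def)
  define d' where "d' = (1 / n) *\<^sub>R g' - (r / n ^ 3) *\<^sub>R g x"
  have "cinner g' (g x) = cnj (cinner (g x) g')"
    by (rule cinner_commute)
  moreover have gg': "cinner (g x) g' = Complex r s"
    by (simp add: r_def s_def)
  ultimately have g'g: "cinner g' (g x) = Complex r (- s)"
    by (simp add: complex_eq_iff)
  have "Re (cinner d' d') = (norm g')\<^sup>2 / n\<^sup>2 - r\<^sup>2 / n ^ 4"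
    unfolding d'_def cinner_diff_left cinner_diff_right cinner_scaleR_left cinner_scaleR_right
      gg' g'g
    unfolding cinner_self n_def[symmetric]
    using n by (simp add: field_simps eval_nat_numeral)
  \<comment> \<open>A curve of unit vectors has purely imaginary overlap with its velocity.\<close>
  moreover have "cinner ((1 / n) *\<^sub>R g x) d' = Complex 0 (s / n\<^sup>2)"
    unfolding d'_def cinner_diff_right cinner_scaleR_left cinner_scaleR_right
      gg' cinner_self n_def[symmetric]
    using n by (simp add: complex_eq_iff field_simps eval_nat_numeral)
  then have "(cmod (cinner ((1 / n) *\<^sub>R g x) d'))\<^sup>2 = s\<^sup>2 / n ^ 4"
    by (simp add: cmod_power2 power_divide power_mult[symmetric])
  moreover have "(cmod (cinner (g x) g'))\<^sup>2 = r\<^sup>2 + s\<^sup>2"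
    by (simp add: gg' cmod_power2)
  ultimately show ?thesis
    using vector_derivative_at[OF d]
    by (simp add: QFI_def d'_def[symmetric] n_def[symmetric] add_divide_distrib)
qed

lemma outcome_prob_eq_norm:
  assumes "bounded_clinear (K \<omega>)"
  shows "outcome_prob K \<psi> \<omega> x = (norm (K \<omega> (\<psi> x)))\<^sup>2"
  by (simp add: outcome_prob_def cinner_povm[of K \<omega>, OF assms] cinner_self)

text \<open>The conditional state is the normalisation of \<open>K \<omega> (\<psi> t)\<close>,
  whose velocity is \<open>(- \<i>) *\<^sub>C K \<omega> w\<close> since \<open>K \<omega>\<close>
  is fixed and complex linear. The factor \<open>p\<close> cancels one squared norm.\<close>

lemma outcome_prob_mult_QFI:
  assumes K: "bounded_clinear (K \<omega>)"
    and \<psi>: "(\<psi> has_vector_derivative (- \<i>) *\<^sub>C w) (at x)"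
    and p: "outcome_prob K \<psi> \<omega> x > 0"
  shows "outcome_prob K \<psi> \<omega> x * QFI (cond_state K \<psi> \<omega>) x
    = 4 * (Re (cinner w (povm K \<omega> w))
        - (cmod (cinner (\<psi> x) (povm K \<omega> w)))\<^sup>2 / outcome_prob K \<psi> \<omega> x)"
proof -
  define n where "n = norm (K \<omega> (\<psi> x))"
  have nz: "K \<omega> (\<psi> x) \<noteq> 0"
    using p outcome_prob_eq_norm[of K \<omega> \<psi> x, OF K] by auto
  then have n: "n > 0"
    by (simp add: n_def)
  have "((\<lambda>t. K \<omega> (\<psi> t)) has_vector_derivative K \<omega> ((- \<i>) *\<^sub>C w)) (at x)"
    using K \<psi> unfolding bounded_clinear_def by (blast intro: bounded_linear.has_vector_derivative)
  then have "((\<lambda>t. K \<omega> (\<psi> t)) has_vector_derivative (- \<i>) *\<^sub>C K \<omega> w) (at x)"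
    using K unfolding bounded_clinear_def by simp
  from QFI_normalised[OF this nz]
  have "QFI (cond_state K \<psi> \<omega>) x
      = 4 * ((norm (K \<omega> w))\<^sup>2 / n\<^sup>2 - (cmod (cinner (K \<omega> (\<psi> x)) (K \<omega> w)))\<^sup>2 / n ^ 4)"
    by (simp add: cond_state_def[abs_def] outcome_prob_eq_norm[of K \<omega>, OF K] norm_scaleC
        cinner_scaleC_right norm_mult n_def)
  then show ?thesis
    using n by (simp add: outcome_prob_eq_norm[of K \<omega>, OF K] cinner_povm[of K \<omega>, OF K] cinner_self n_def[symmetric]
        field_simps eval_nat_numeral)
qed


section \<open>Self-adjoint operators and tensor products\<close>

lemma op_app_in_graph:
  assumes "selfadjoint T" "x \<in> Domain T"
  shows "(x, op_app T x) \<in> T"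
proof -
  have "single_valued T"
    using assms by (simp add: selfadjoint_def linear_graph_def)
  with assms(2) have "\<exists>!y. (x, y) \<in> T"
    by (auto simp: single_valued_def)
  then show ?thesis
    unfolding op_app_def by (rule theI')
qed

text \<open>The pair of \<open>x\<close> and its image lies in the adjoint graph and can be tested
  against itself.\<close>

lemma moment1_real:
  assumes "selfadjoint T" "x \<in> Domain T"
  shows "cnj (moment1 T x) = moment1 T x"
proof -
  have "(x, op_app T x) \<in> adjoint_graph T"
    using assms op_app_in_graph by (simp add: selfadjoint_def)
  then have "cinner x (op_app T x) = cinner (op_app T x) x"
    using op_app_in_graph[OF assms] by (auto simp: adjoint_graph_def)
  then show ?thesis
    unfolding moment1_def by (metis cinner_commute)
qed

lemma norm_tens:
  assumes "hilbert_tensor tens"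
  shows "norm (tens a b) = norm a * norm b"
proof -
  have "cinner (tens a b) (tens a b) = cinner a a * cinner b b"
    using assms by (simp add: hilbert_tensor_def)
  then have "complex_of_real ((norm (tens a b))\<^sup>2) = of_real ((norm a * norm b)\<^sup>2)"
    by (simp add: cinner_self power_mult_distrib)
  then have "(norm (tens a b))\<^sup>2 = (norm a * norm b)\<^sup>2"
    using of_real_eq_iff by blast
  then show ?thesis
    by simp
qed

text \<open>The pair of pure tensors is a generator of \<open>tensor_graph\<close>, and
  \<open>is_unitary_exp\<close> identifies that graph with the derivatives of the group at
  \<open>0\<close>.\<close>

lemma tensor_exp_has_vector_derivative:
  assumes "is_unitary_exp (tensor_graph tens S T) U" "(a, a') \<in> S" "(b, b') \<in> T"
  shows "((\<lambda>t. U t (tens a b)) has_vector_derivative (- \<i>) *\<^sub>C tens a' b') (at 0)"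
proof -
  have "(tens a b, tens a' b') \<in> tensor_graph tens S T"
    unfolding tensor_graph_def
    by (rule closure_subset[THEN subsetD], rule span_base) (use assms in blast)
  then show ?thesis
    using assms(1) unfolding is_unitary_exp_def by blast
qed

text \<open>If each outcome keeps the fraction \<open>q \<omega>\<close> of the information, the
  fractions sum to one and nothing is lost; the gain only divides each fraction by its
  probability.\<close>

lemma lossless_summary:
  assumes "\<And>\<omega>. \<omega> \<in> R \<Longrightarrow> outcome_prob K \<psi> \<omega> x * QFI (cond_state K \<psi> \<omega>) x = q \<omega> * QFI \<psi> x"
    and p: "\<And>\<omega>. \<omega> \<in> R \<Longrightarrow> outcome_prob K \<psi> \<omega> x > 0"
    and "QFI \<psi> x > 0" and "(\<Sum>\<omega>\<in>R. q \<omega>) = 1"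
  shows "loss R K \<psi> x = 0"
    and "compression_gain R K \<psi> x = (\<Sum>\<omega>\<in>R. q \<omega> / outcome_prob K \<psi> \<omega> x)"
proof -
  have "outcome_prob K \<psi> \<omega> x * QFI (cond_state K \<psi> \<omega>) x / QFI \<psi> x = q \<omega>"
    and "QFI (cond_state K \<psi> \<omega>) x / QFI \<psi> x = q \<omega> / outcome_prob K \<psi> \<omega> x" if "\<omega> \<in> R" for \<omega>
    using assms(1)[OF that] assms(3) p[OF that] by (simp_all add: field_simps)
  then show "loss R K \<psi> x = 0"
    and "compression_gain R K \<psi> x = (\<Sum>\<omega>\<in>R. q \<omega> / outcome_prob K \<psi> \<omega> x)"
    using assms(4) by (simp_all add: loss_def compression_gain_def)
qed

section \<open>Loss, capacity and gain of the two post-selections\<close>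

theorem mainTheorem4:
  fixes HA :: "('a::chilbert_space \<times> 'a) set"
    and HB :: "('b::chilbert_space \<times> 'b) set"
    and tens :: "'a \<Rightarrow> 'b \<Rightarrow> 'c::chilbert_space"
    and U :: "real \<Rightarrow> 'c \<Rightarrow> 'c"
    and \<phi>0 :: 'a and \<chi>0 :: 'b
    and \<psi> :: "real \<Rightarrow> 'c"
    and R D :: "'w set"
    and K :: "'w \<Rightarrow> 'c \<Rightarrow> 'c"
    and EA :: "'w \<Rightarrow> 'a \<Rightarrow> 'a"
    and q :: "'w \<Rightarrow> real"
  assumes HA: "selfadjoint HA" and HB: "selfadjoint HB"
    and tens: "hilbert_tensor tens"
    and U: "is_unitary_exp (tensor_graph tens HA HB) U"
    and \<phi>0: "norm \<phi>0 = 1" "\<phi>0 \<in> Domain HA"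
    and \<chi>0: "norm \<chi>0 = 1" "\<chi>0 \<in> Domain HB"
    and \<psi>: "\<And>x. \<psi> x = U x (tens \<phi>0 \<chi>0)"
    and mA: "moment2 HA \<phi>0 > 0" and mB: "moment2 HB \<chi>0 > 0"
    and K: "post_selection R D K"
    and EA: "\<And>\<omega>. \<omega> \<in> R \<Longrightarrow> is_tensor_op tens (povm K \<omega>) (EA \<omega>) id"
    and q: "\<And>\<omega>. \<omega> \<in> R \<Longrightarrow> q \<omega> > 0" "(\<Sum>\<omega>\<in>R. q \<omega>) = 1"
  shows "(\<forall>\<epsilon>::real.
      moment1 HA \<phi>0 = 0 \<and> 0 < \<epsilon> \<and> \<epsilon> < 1 / real (card R) \<and>
      (\<forall>\<omega>\<in>R. EA \<omega> = (\<lambda>v. q \<omega> *\<^sub>R rho_perp HA \<phi>0 v + \<epsilon> *\<^sub>R ketbra \<phi>0 \<phi>0 v)) \<longrightarrow>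
        loss R K \<psi> 0 = 0 \<and>
        compression_gain R K \<psi> 0 = real (card R) * compression_capacity R K \<psi> 0 \<and>
        real (card R) * compression_capacity R K \<psi> 0 = 1 / \<epsilon>) \<and>
    (moment1 HA \<phi>0 \<noteq> 0 \<and> moment1 HB \<chi>0 = 0 \<and>
      (\<forall>\<omega>\<in>R. EA \<omega> = (\<lambda>v. q \<omega> *\<^sub>R rho_perp HA \<phi>0 v)) \<longrightarrow>
        loss R K \<psi> 0 = 0 \<and>
        complex_of_real (compression_capacity R K \<psi> 0) =
          complex_of_real (moment2 HA \<phi>0) / (moment1 HA \<phi>0)\<^sup>2 \<and>
        compression_gain R K \<psi> 0 = real (card R) * compression_capacity R K \<psi> 0)"
proof -
  define a where "a = op_app HA \<phi>0"
  define b where "b = op_app HB \<chi>0"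
  have a: "(\<phi>0, a) \<in> HA" and b: "(\<chi>0, b) \<in> HB"
    unfolding a_def b_def using op_app_in_graph HA HB \<phi>0 \<chi>0 by auto
  have m1A: "moment1 HA \<phi>0 = cinner \<phi>0 a" and m1B: "moment1 HB \<chi>0 = cinner \<chi>0 b"
    and m2A: "moment2 HA \<phi>0 = (norm a)\<^sup>2" and m2B: "moment2 HB \<chi>0 = (norm b)\<^sup>2"
    by (simp_all add: moment1_def moment2_def a_def b_def)
  have na: "norm a > 0" and nb: "norm b > 0"
    using mA mB m2A m2B by auto
  have tc: "cinner (tens u v) (tens u' v') = cinner u u' * cinner v v'" for u v u' v'
    using tens by (simp add: hilbert_tensor_def)
  have "\<psi> = (\<lambda>t. U t (tens \<phi>0 \<chi>0))"
    using \<psi> by auto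
  then have d\<psi>: "(\<psi> has_vector_derivative (- \<i>) *\<^sub>C tens a b) (at 0)"
    using tensor_exp_has_vector_derivative[OF U a b] by simp
  have \<psi>0: "\<psi> 0 = tens \<phi>0 \<chi>0"
    using \<psi> U by (simp add: is_unitary_exp_def)
  have fin: "finite R" and bc: "\<And>\<omega>. \<omega> \<in> R \<Longrightarrow> bounded_clinear (K \<omega>)"
    using K by (auto simp: post_selection_def)
  have "R \<noteq> {}"
    using q(2) by auto
  with fin have L: "real (card R) > 0"
    by (simp add: card_gt_0_iff)
  have povm: "povm K \<omega> (tens u v) = tens (EA \<omega> u) v" if "\<omega> \<in> R" for \<omega> u v
    using EA[OF that] by (simp add: is_tensor_op_def)
  have prob: "outcome_prob K \<psi> \<omega> 0 = Re (cinner \<phi>0 (EA \<omega> \<phi>0))" if "\<omega> \<in> R" for \<omega>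
    using \<chi>0 by (simp add: outcome_prob_def \<psi>0 povm[OF that] tc cinner_self)
  have rho: "rho_perp HA \<phi>0 v = (1 / (norm a)\<^sup>2) *\<^sub>R (cinner a v *\<^sub>C a)" for v
    by (simp add: rho_perp_def ketbra_def m2A a_def[symmetric])
  \<comment> \<open>\<open>rho_perp HA \<phi>0\<close> is the orthogonal projection onto the line of
    \<open>a\<close>.\<close>
  have rho_a: "rho_perp HA \<phi>0 a = a"
    using na scaleR_one[of a] unfolding rho cinner_self scaleR_scaleC[symmetric] by simp
  \<comment> \<open>The common core of both cases. \<open>orth\<close> says that the state is
    orthogonal to \<open>tens a b\<close>; either factor may be the one that vanishes.\<close>
  have info: "loss R K \<psi> 0 = 0"
      "compression_gain R K \<psi> 0 = (\<Sum>\<omega>\<in>R. q \<omega> / outcome_prob K \<psi> \<omega> 0)"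
    if EAa: "\<And>\<omega>. \<omega> \<in> R \<Longrightarrow> EA \<omega> a = q \<omega> *\<^sub>R a"
      and p: "\<And>\<omega>. \<omega> \<in> R \<Longrightarrow> outcome_prob K \<psi> \<omega> 0 > 0"
      and orth: "cinner \<phi>0 a * cinner \<chi>0 b = 0"
  proof -
    have Q: "QFI \<psi> 0 = 4 * ((norm a)\<^sup>2 * (norm b)\<^sup>2)"
      using QFI_eq[OF d\<psi>] orth by (simp add: \<psi>0 tc norm_tens[OF tens] power_mult_distrib)
    \<comment> \<open>By the eigenvalue relation \<open>EAa\<close> the subtracted overlap is a
      multiple of \<open>orth\<close>, hence zero.\<close>
    have "outcome_prob K \<psi> \<omega> 0 * QFI (cond_state K \<psi> \<omega>) 0 = q \<omega> * QFI \<psi> 0" if "\<omega> \<in> R" for \<omega>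
      using outcome_prob_mult_QFI[OF bc[OF that] d\<psi> p[OF that]] orth
      unfolding Q \<psi>0 povm[OF that] EAa[OF that] tc cinner_scaleR_right cinner_self
      by auto
    moreover have "QFI \<psi> 0 > 0"
      using na nb Q by simp
    ultimately show "loss R K \<psi> 0 = 0"
      and "compression_gain R K \<psi> 0 = (\<Sum>\<omega>\<in>R. q \<omega> / outcome_prob K \<psi> \<omega> 0)"
      using lossless_summary[of R K \<psi> 0 q] p q(2) by blast+
  qed
  show ?thesis
  proof (intro conjI allI impI; elim conjE)

    \<comment> \<open>Vanishing mean of \<open>HA\<close>\<close>
    fix \<epsilon> :: real
    assume m0: "moment1 HA \<phi>0 = 0" and \<epsilon>: "0 < \<epsilon>"
      and E: "\<forall>\<omega>\<in>R. EA \<omega> = (\<lambda>v. q \<omega> *\<^sub>R rho_perp HA \<phi>0 v + \<epsilon> *\<^sub>R ketbra \<phi>0 \<phi>0 v)"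
    have "cinner \<phi>0 a = 0"
      using m0 m1A by simp
    then have "cinner a \<phi>0 = 0"
      by (metis cinner_commute complex_cnj_zero)
    have zero: "(0::complex) *\<^sub>C u = 0" for u :: 'a
      using scaleR_scaleC[of 0 u] by simp
    have EAa: "EA \<omega> a = q \<omega> *\<^sub>R a" if "\<omega> \<in> R" for \<omega>
      using E that rho_a \<open>cinner \<phi>0 a = 0\<close> by (simp add: ketbra_def zero)
    \<comment> \<open>The projection kills \<open>\<phi>0\<close>, so only the \<epsilon> term
      contributes, equally for all outcomes.\<close>
    have p: "outcome_prob K \<psi> \<omega> 0 = \<epsilon>" if "\<omega> \<in> R" for \<omega>
      using E that \<open>cinner a \<phi>0 = 0\<close> \<phi>0(1)
      by (simp add: prob ketbra_def rho zero cinner_scaleR_right cinner_scaleC_right cinner_self)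
    have "loss R K \<psi> 0 = 0"
        "compression_gain R K \<psi> 0 = (\<Sum>\<omega>\<in>R. q \<omega> / outcome_prob K \<psi> \<omega> 0)"
      using info EAa p \<epsilon> \<open>cinner \<phi>0 a = 0\<close> by auto
    moreover have "(\<Sum>\<omega>\<in>R. q \<omega> / outcome_prob K \<psi> \<omega> 0) = 1 / \<epsilon>"
      using p q(2) by (simp add: sum_divide_distrib[symmetric])
    moreover have "real (card R) * compression_capacity R K \<psi> 0 = 1 / \<epsilon>"
      using p L by (simp add: compression_capacity_def)
    ultimately show "loss R K \<psi> 0 = 0"
      and "compression_gain R K \<psi> 0 = real (card R) * compression_capacity R K \<psi> 0"
      and "real (card R) * compression_capacity R K \<psi> 0 = 1 / \<epsilon>"
      by simp_all
  next

    \<comment> \<open>Nonzero mean of \<open>HA\<close>, vanishing mean of \<open>HB\<close>\<close>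
    assume m0: "moment1 HA \<phi>0 \<noteq> 0" and mB0: "moment1 HB \<chi>0 = 0"
      and E: "\<forall>\<omega>\<in>R. EA \<omega> = (\<lambda>v. q \<omega> *\<^sub>R rho_perp HA \<phi>0 v)"
    define m where "m = Re (moment1 HA \<phi>0)"
    have m: "moment1 HA \<phi>0 = of_real m"
      using moment1_real[OF HA \<phi>0(2)] by (simp add: m_def complex_eq_iff)
    have "cinner \<phi>0 a = of_real m"
      using m m1A by simp
    then have "cinner a \<phi>0 = of_real m"
      by (metis cinner_commute complex_cnj_complex_of_real)
    have "m \<noteq> 0"
      using m m0 by simp
    \<comment> \<open>The expectation of \<open>rho_perp HA \<phi>0\<close> in
      \<open>\<phi>0\<close>, which is also the total retained probability.\<close>
    define \<kappa> where "\<kappa> = m\<^sup>2 / (norm a)\<^sup>2"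
    have \<kappa>: "\<kappa> > 0"
      using \<open>m \<noteq> 0\<close> na by (simp add: \<kappa>_def)
    have EAa: "EA \<omega> a = q \<omega> *\<^sub>R a" if "\<omega> \<in> R" for \<omega>
      using E that rho_a by simp
    have p: "outcome_prob K \<psi> \<omega> 0 = q \<omega> * \<kappa>" if "\<omega> \<in> R" for \<omega>
      using E that \<open>cinner a \<phi>0 = of_real m\<close> \<open>cinner \<phi>0 a = of_real m\<close>
      by (simp add: prob rho cinner_scaleR_right cinner_scaleC_right \<kappa>_def power2_eq_square)
    have "loss R K \<psi> 0 = 0"
        "compression_gain R K \<psi> 0 = (\<Sum>\<omega>\<in>R. q \<omega> / outcome_prob K \<psi> \<omega> 0)"
      using info EAa p q(1) \<kappa> mB0 m1B by auto
    \<comment> \<open>The weight cancels against the one in the probability, so each outcome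
      contributes the capacity once.\<close>
    moreover have "(\<Sum>\<omega>\<in>R. q \<omega> / outcome_prob K \<psi> \<omega> 0) = (\<Sum>\<omega>\<in>R. 1 / \<kappa>)"
      by (rule sum.cong) (use p q(1) in \<open>force+\<close>)
    moreover have cap: "compression_capacity R K \<psi> 0 = 1 / \<kappa>"
      using p q(2) by (simp add: compression_capacity_def sum_distrib_right[symmetric])
    ultimately show "loss R K \<psi> 0 = 0"
      and "compression_gain R K \<psi> 0 = real (card R) * compression_capacity R K \<psi> 0"
      by simp_all
    show "complex_of_real (compression_capacity R K \<psi> 0) =
        complex_of_real (moment2 HA \<phi>0) / (moment1 HA \<phi>0)\<^sup>2"
      by (simp add: cap \<kappa>_def m m2A)
  qed
qed

end
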